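(* Let $n\in\mathbb{N}$ and $s\in\mathbb{C}\setminus\{-1,-2,-3,\dots\}$. Then \[ \sum_{k=1}^{n}\binom{s+n}{k}\frac{(-1)^{k-1}}{k}=H_n+ s\sum_{k=0}^{n-1}\frac{(-1)^k\binom{s+k}{k}}{(k+1)^2\binom{n}{k+1}}. \]
   Context: $H_n=\sum_{j=1}^n\frac1j$. For $z\in\mathbb{C}$ and $k\in\mathbb{N}_0$, $\binom{z}{k}=\frac{z(z-1)\cdots(z-k+1)}{k!}$. *)

theory Defs
  imports "HOL-Analysis.Analysis"
begin

end

theory Submission
  imports Defs
begin

text \<open>
  Induction on \<open>n\<close>. Pascal's rule and the closed form of alternating partial row sums give the
  increment of the left-hand side. On the right, the increment involves
  \<open>1 / (n + 1 choose k + 1) - 1 / (n choose k + 1)\<close>, which is a multiple of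
  \<open>(k + 1) / (n choose k + 1)\<close>, and this reduces it to a sum that telescopes through the terms
  \<open>(-1)^k (s + k choose k) / (n choose k)\<close>.
\<close>

lemma gbinomial_Suc_right:
  fixes a :: "'a::field_char_0"
  shows "of_nat (Suc k) * (a gchoose Suc k) = (a - of_nat k) * (a gchoose k)"
  by (simp only: gbinomial_absorption gbinomial_absorb_comp)

lemma of_nat_gbinomial_neq_0:
  assumes "k \<le> n"
  shows "(of_nat n gchoose k :: 'a::field_char_0) \<noteq> 0"
  using assms by (simp flip: binomial_gbinomial)

text \<open>This evaluates the sum with only a first power of \<open>of_nat (Suc k)\<close>, which
  is what remains of the squared sum after passing from row \<open>n\<close> to row
  \<open>Suc n\<close>. Up to the constant factor \<open>1 / (s + of_nat (Suc n))\<close>, each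
  summand is a difference of consecutive terms \<open>t k\<close>, so the sum telescopes.\<close>

lemma sum_gbinomial_div_gbinomial:
  fixes s :: "'a::field_char_0"
  assumes "s + of_nat (Suc n) \<noteq> 0"
  shows "(\<Sum>k<n. (-1) ^ k * ((s + of_nat k) gchoose k) /
            (of_nat (Suc k) * (of_nat n gchoose Suc k))) =
         (1 - (-1) ^ n * ((s + of_nat n) gchoose n)) / (s + of_nat (Suc n))"
proof -
  define t :: "nat \<Rightarrow> 'a" where
    "t k = (-1) ^ k * ((s + of_nat k) gchoose k) / (of_nat n gchoose k)" for k
  have step: "(-1) ^ k * ((s + of_nat k) gchoose k) / (of_nat (Suc k) * (of_nat n gchoose Suc k)) =
      (t k - t (Suc k)) / (s + of_nat (Suc n))" if "k < n" for k
  proof -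
    define c :: 'a where "c = (s + of_nat k) gchoose k"
    define d :: 'a where "d = (s + of_nat (Suc k)) gchoose Suc k"
    define p :: 'a where "p = of_nat n gchoose k"
    define q :: 'a where "q = of_nat n gchoose Suc k"
    define m :: 'a where "m = of_nat (Suc k)"
    define e :: 'a where "e = (-1) ^ k"
    define S :: 'a where "S = s + of_nat (Suc n)"
    have "p \<noteq> 0" "q \<noteq> 0" "m \<noteq> 0" "S \<noteq> 0"
      using assms that of_nat_gbinomial_neq_0[of k n] of_nat_gbinomial_neq_0[of "Suc k" n]
      by (simp_all add: p_def q_def m_def S_def del: of_nat_Suc)
    have md: "m * d = (s + m) * c"
      using gbinomial_absorption[of k "s + of_nat (Suc k)"] by (simp add: m_def d_def c_def)
    have mq: "m * q = (of_nat n - (m - 1)) * p"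
      using gbinomial_Suc_right[of k "of_nat n :: 'a"] by (simp add: m_def q_def p_def)
    \<comment> \<open>By \<open>mq\<close> and \<open>md\<close> both products are multiples of
      \<open>c * p\<close>, with factors \<open>n - k\<close> and \<open>s + k + 1\<close>. Their
      sum \<open>S\<close> is independent of \<open>k\<close>, which makes the telescoping
      possible.\<close>
    have key: "(c * q + d * p) * m = c * p * S"
    proof -
      have "(c * q + d * p) * m = c * (m * q) + (m * d) * p"
        by (simp add: algebra_simps)
      also have "\<dots> = c * p * S"
        unfolding md mq by (simp add: S_def algebra_simps)
      finally show ?thesis .
    qed
    have "c * (p * q * S) = q * (c * p * S)"
      by (simp add: mult_ac)
    also have "\<dots> = (c * q + d * p) * (m * q)"
      unfolding key[symmetric] by (simp add: mult_ac)
    finally have "c / (m * q) = (c / p + d / q) / S"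
      using \<open>p \<noteq> 0\<close> \<open>q \<noteq> 0\<close> \<open>m \<noteq> 0\<close> \<open>S \<noteq> 0\<close>
      by (simp only: add_frac_eq divide_divide_eq_left frac_eq_eq mult_eq_0_iff simp_thms)
    then have "e * (c / (m * q)) = e * ((c / p + d / q) / S)"
      by simp
    then have "e * c / (m * q) = (e * c / p - - e * d / q) / S"
      by (simp add: distrib_left)
    then show ?thesis
      by (simp add: t_def c_def d_def p_def q_def m_def e_def S_def)
  qed
  have "(\<Sum>k<n. (-1) ^ k * ((s + of_nat k) gchoose k) /
            (of_nat (Suc k) * (of_nat n gchoose Suc k))) =
        (\<Sum>k<n. (t k - t (Suc k)) / (s + of_nat (Suc n)))"
    using step by (intro sum.cong) auto
  also have "\<dots> = (t 0 - t n) / (s + of_nat (Suc n))"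
    by (simp only: sum_divide_distrib[symmetric] sum_lessThan_telescope')
  \<comment> \<open>Both boundary denominators, \<open>n choose 0\<close> and
    \<open>n choose n\<close>, are 1.\<close>
  also have "\<dots> = (1 - (-1) ^ n * ((s + of_nat n) gchoose n)) / (s + of_nat (Suc n))"
    by (simp add: t_def flip: binomial_gbinomial)
  finally show ?thesis .
qed

text \<open>Absorption gives \<open>(N - (k + 1)) * p = N * q\<close> for the entries
  \<open>p\<close>, \<open>q\<close> of rows \<open>n + 1\<close> and \<open>n\<close>; dividing by
  \<open>N * p * q\<close> yields the claim. The numerator \<open>of_nat (Suc k)\<close> later
  cancels one factor of the square.\<close>

lemma inverse_gbinomial_Suc_diff:
  assumes "k < n"
  shows "1 / (of_nat (Suc n) gchoose Suc k) =
    1 / (of_nat n gchoose Suc k) -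
    of_nat (Suc k) / (of_nat (Suc n) * (of_nat n gchoose Suc k) :: 'a::field_char_0)"
proof -
  define p :: 'a where "p = of_nat (Suc n) gchoose Suc k"
  define q :: 'a where "q = of_nat n gchoose Suc k"
  define N :: 'a where "N = of_nat (Suc n)"
  have "p \<noteq> 0" "q \<noteq> 0" "N \<noteq> 0"
    using assms of_nat_gbinomial_neq_0[of "Suc k" "Suc n"] of_nat_gbinomial_neq_0[of "Suc k" n]
    by (simp_all add: p_def q_def N_def del: of_nat_Suc)
  have "(N - of_nat (Suc k)) * p = N * q"
    using gbinomial_absorb_comp[of N "Suc k"] by (simp add: p_def q_def N_def)
  then have "1 / p = 1 / q - of_nat (Suc k) / (N * q)"
    using \<open>p \<noteq> 0\<close> \<open>q \<noteq> 0\<close> \<open>N \<noteq> 0\<close>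
    by (simp add: divide_simps mult_ac del: of_nat_Suc)
  then show ?thesis
    by (simp add: p_def q_def N_def)
qed

text \<open>Pascal's rule splits each term. In the part with \<open>x gchoose (k - 1)\<close>,
  absorption trades the denominator \<open>k\<close> for the constant \<open>x + 1\<close>, leaving
  an alternating partial row sum that has a closed form.\<close>

lemma sum_gbinomial_Suc_alternating:
  fixes x :: "'a::field_char_0"
  assumes "x + 1 \<noteq> 0"
  shows "(\<Sum>k = 1..Suc n. ((x + 1) gchoose k) * ((-1) ^ (k - 1) / of_nat k)) =
    (\<Sum>k = 1..n. (x gchoose k) * ((-1) ^ (k - 1) / of_nat k)) +
    (-1) ^ n * (x gchoose Suc n) / of_nat (Suc n) +
    (1 + (-1) ^ n * (x gchoose Suc n)) / (x + 1)"
proof -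
  have pascal: "((x + 1) gchoose Suc k) * ((-1) ^ k / of_nat (Suc k)) =
      (x gchoose Suc k) * ((-1) ^ k / of_nat (Suc k)) -
      ((x + 1) gchoose Suc k) * (-1) ^ Suc k / (x + 1)" for k
  proof -
    define m :: 'a where "m = of_nat (Suc k)"
    have "m \<noteq> 0" by (simp add: m_def del: of_nat_Suc)
    have ab: "(x gchoose k) = m * ((x + 1) gchoose Suc k) / (x + 1)"
      using gbinomial_absorption[of k "x + 1"] assms by (simp add: m_def field_simps)
    have "((x + 1) gchoose Suc k) = (x gchoose k) + (x gchoose Suc k)"
      by (rule gbinomial_Suc_Suc)
    then have "((x + 1) gchoose Suc k) * ((-1) ^ k / m) =
        (x gchoose Suc k) * ((-1) ^ k / m) + (x gchoose k) * ((-1) ^ k / m)"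
      by (simp only: distrib_right add.commute)
    also have "(x gchoose k) * ((-1) ^ k / m) = - (((x + 1) gchoose Suc k) * (-1) ^ Suc k / (x + 1))"
      unfolding ab using \<open>m \<noteq> 0\<close> by simp
    finally show ?thesis by (simp add: m_def)
  qed
  \<comment> \<open>The leading 1 is the term of index 0 in the partial row sum, split off by the
    index shift.\<close>
  have "1 + (\<Sum>k\<le>n. ((x + 1) gchoose Suc k) * (-1) ^ Suc k) = (-1) ^ Suc n * (x gchoose Suc n)"
    using gbinomial_sum_lower_neg[of "x + 1" "Suc n"]
    by (simp add: sum.atMost_Suc_shift del: sum.atMost_Suc power_Suc)
  then have alt: "(\<Sum>k\<le>n. ((x + 1) gchoose Suc k) * (-1) ^ Suc k) =
      - (1 + (-1) ^ n * (x gchoose Suc n))"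
    by (simp add: add_eq_0_iff2 eq_diff_eq[symmetric] add.commute[of 1] del: sum.atMost_Suc)
  have shift: "(\<Sum>k = 1..Suc j. f k) = (\<Sum>k\<le>j. f (Suc k))" for f :: "nat \<Rightarrow> 'a" and j
    by (simp only: One_nat_def atMost_atLeast0 sum.shift_bounds_cl_Suc_ivl)
  have "(\<Sum>k = 1..Suc n. ((x + 1) gchoose k) * ((-1) ^ (k - 1) / of_nat k)) =
      (\<Sum>k\<le>n. (x gchoose Suc k) * ((-1) ^ k / of_nat (Suc k))) -
      (\<Sum>k\<le>n. ((x + 1) gchoose Suc k) * (-1) ^ Suc k / (x + 1))"
    by (simp only: shift diff_Suc_1 pascal sum_subtractf)
  \<comment> \<open>This sum runs up to \<open>Suc n\<close>; its last term is the middle summand of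
    the claim.\<close>
  also have "(\<Sum>k\<le>n. (x gchoose Suc k) * ((-1) ^ k / of_nat (Suc k))) =
      (\<Sum>k = 1..Suc n. (x gchoose k) * ((-1) ^ (k - 1) / of_nat k))"
    by (simp only: shift diff_Suc_1)
  also have "(\<Sum>k\<le>n. ((x + 1) gchoose Suc k) * (-1) ^ Suc k / (x + 1)) =
      - (1 + (-1) ^ n * (x gchoose Suc n)) / (x + 1)"
    by (simp only: sum_divide_distrib[symmetric] alt)
  finally show ?thesis
    by (simp add: diff_divide_distrib add_divide_distrib mult.commute del: of_nat_Suc)
qed

lemma sum_gbinomial_div_square_Suc:
  fixes s :: "'a::field_char_0"
  assumes "s + of_nat (Suc n) \<noteq> 0"
  shows "(\<Sum>k<Suc n. (-1) ^ k * ((s + of_nat k) gchoose k) /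
            (of_nat (Suc k) ^ 2 * (of_nat (Suc n) gchoose Suc k))) =
    (\<Sum>k<n. (-1) ^ k * ((s + of_nat k) gchoose k) /
            (of_nat (Suc k) ^ 2 * (of_nat n gchoose Suc k))) -
    (1 - (-1) ^ n * ((s + of_nat n) gchoose n)) / (of_nat (Suc n) * (s + of_nat (Suc n))) +
    (-1) ^ n * ((s + of_nat n) gchoose n) / of_nat (Suc n) ^ 2"
proof -
  define a where "a k = (-1) ^ k * ((s + of_nat k) gchoose k)" for k
  have "a k / (of_nat (Suc k) ^ 2 * (of_nat (Suc n) gchoose Suc k)) =
      a k / (of_nat (Suc k) ^ 2 * (of_nat n gchoose Suc k)) -
      a k / (of_nat (Suc k) * (of_nat n gchoose Suc k)) / of_nat (Suc n)" if "k < n" for k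
  proof -
    have "a k / (of_nat (Suc k) ^ 2 * (of_nat (Suc n) gchoose Suc k)) =
        a k / of_nat (Suc k) ^ 2 * (1 / (of_nat (Suc n) gchoose Suc k))"
      by simp
    also have "\<dots> = a k / (of_nat (Suc k) ^ 2 * (of_nat n gchoose Suc k)) -
        a k / (of_nat (Suc k) * (of_nat n gchoose Suc k)) / of_nat (Suc n)"
      unfolding inverse_gbinomial_Suc_diff[OF that]
      by (simp add: right_diff_distrib power2_eq_square mult_ac del: of_nat_Suc)
    finally show ?thesis .
  qed
  then have "(\<Sum>k<n. a k / (of_nat (Suc k) ^ 2 * (of_nat (Suc n) gchoose Suc k))) =
      (\<Sum>k<n. a k / (of_nat (Suc k) ^ 2 * (of_nat n gchoose Suc k))) -
      (\<Sum>k<n. a k / (of_nat (Suc k) * (of_nat n gchoose Suc k))) / of_nat (Suc n)"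
    by (simp add: sum_subtractf sum_divide_distrib del: of_nat_Suc)
  \<comment> \<open>The term \<open>k = n\<close> is absent from the sum for row \<open>n\<close>;
    with this value it becomes the last summand of the claim.\<close>
  moreover have "(of_nat (Suc n) gchoose Suc n :: 'a) = 1"
    by (simp flip: binomial_gbinomial del: of_nat_Suc)
  ultimately show ?thesis
    using sum_gbinomial_div_gbinomial[OF assms]
    by (simp add: a_def mult.commute del: of_nat_Suc)
qed

theorem theorem2p6:
  fixes n :: nat and s :: complex
  assumes "n \<ge> 1"
    and "s \<notin> {- of_nat m | m :: nat. m \<ge> 1}"
  shows "(\<Sum>k = 1..n. ((s + of_nat n) gchoose k) * ((-1) ^ (k - 1) / of_nat k)) =
    harm n + s * (\<Sum>k = 0..n - 1. ((-1) ^ k * ((s + of_nat k) gchoose k)) /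
                   (of_nat (k + 1) ^ 2 * (of_nat n gchoose (k + 1))))"
proof -
  have nz: "s + of_nat (Suc m) \<noteq> 0" for m
    using assms(2) by (auto simp: add_eq_0_iff2 simp del: of_nat_Suc)
  \<comment> \<open>Summing over \<open>k < m\<close> lets the induction start at 0 with empty
    sums.\<close>
  have main: "(\<Sum>k = 1..m. ((s + of_nat m) gchoose k) * ((-1) ^ (k - 1) / of_nat k)) =
      harm m + s * (\<Sum>k<m. (-1) ^ k * ((s + of_nat k) gchoose k) /
                     (of_nat (Suc k) ^ 2 * (of_nat m gchoose Suc k)))" for m
  proof (induction m)
    case 0
    then show ?case by (simp add: harm_def)
  next
    case (Suc m)
    define N :: complex where "N = of_nat (Suc m)"
    define c where "c = (-1) ^ m * ((s + of_nat m) gchoose m)"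
    have N: "N \<noteq> 0" "s + N \<noteq> 0"
      using nz[of m] by (simp_all add: N_def del: of_nat_Suc)
    have x: "s + of_nat m + 1 = s + N"
      by (simp add: N_def)
    \<comment> \<open>The factor \<open>s\<close> on the right-hand side originates here, as
      \<open>(s + m) - m\<close>.\<close>
    have c: "(-1) ^ m * ((s + of_nat m) gchoose Suc m) = s * c / N"
      using gbinomial_Suc_right[of m "s + of_nat m"] N
      by (simp add: c_def N_def field_simps del: of_nat_Suc)
    define A where "A j = (\<Sum>k<j. (-1) ^ k * ((s + of_nat k) gchoose k) /
        (of_nat (Suc k) ^ 2 * (of_nat j gchoose Suc k)))" for j
    have A: "A (Suc m) = A m - (1 - c) / (N * (s + N)) + c / N ^ 2"
      using sum_gbinomial_div_square_Suc[OF nz[of m]] by (simp only: A_def c_def N_def)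
    have "(\<Sum>k = 1..Suc m. ((s + N) gchoose k) * ((-1) ^ (k - 1) / of_nat k)) =
        harm m + s * A m + s * c / N / N + (1 + s * c / N) / (s + N)"
      using sum_gbinomial_Suc_alternating[of "s + of_nat m" m] Suc.IH N(2)
      unfolding x c N_def[symmetric] A_def[symmetric] by (simp only: not_False_eq_True)
    \<comment> \<open>The new harmonic term is split off by
      \<open>1 / (s + N) = 1 / N - s / (N * (s + N))\<close>.\<close>
    also have "\<dots> = harm m + 1 / N + s * (A m - (1 - c) / (N * (s + N)) + c / N ^ 2)"
      using N by (simp add: divide_simps power2_eq_square) (simp add: algebra_simps)
    also have "\<dots> = harm (Suc m) + s * A (Suc m)"
      by (simp add: harm_Suc A N_def inverse_eq_divide del: of_nat_Suc)
    finally show ?case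
      by (simp only: N_def A_def)
  qed
  have "{0..n - 1} = {..<n}"
    using assms(1) by auto
  then show ?thesis
    using main[of n] by simp
qed

end
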